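(* Let $(X,T)$ be a t.d.s., let $n\ge 2$, let $(x_1,\dots,x_n)\in X^n$ be an $\mathcal{F}_{\mathrm{pubd}}$-independent tuple with $x_1,\dots,x_n$ pairwise distinct, and let $U_1,\dots,U_n$ be pairwise disjoint closed neighborhoods of $x_1,\dots,x_n$ respectively. Set $\mathcal{U}=\{X\setminus U_1,\dots,X\setminus U_n\}$. Then $h^F_{\mathrm{top}}(T,\mathcal{U})>0$ for every infinite subset $F$ of $\mathbb{Z}_+$. Consequently, every topological K system is $\mathcal{F}_{\inf}$-scattering.
   Context: $\mathbb{Z}_+=\{0,1,2,\dots\}$, $\mathbb{N}=\{1,2,\dots\}$. A t.d.s. $(X,T)$ is a (nonempty) compact metrizable space $X$ with a surjective continuous map $T:X\to X$. A set $F\subseteq\mathbb{Z}_+$ is an independence set for a tuple $(A_1,\dots,A_k)$ of subsets of $X$ if for every nonempty finite $J\subseteq F$ and every $s\in\{1,\dots,k\}^J$ one has $\bigcap_{j\in J}T^{-j}A_{s(j)}\neq\emptyset$. The upper Banach density of $F\subseteq\mathbb{Z}_+$ is $BD^*(F)=\limsup_{|I|\to+\infty}\frac{|F\cap I|}{|I|}$, with $I$ ranging over nonempty finite intervals of $\mathbb{Z}_+$; $\mathcal{F}_{\mathrm{pubd}}$ is the family of sets with positive upper Banach density, and $\mathcal{F}_{\inf}$ is the family of all infinite subsets of $\mathbb{Z}_+$. A tuple $(x_1,\dots,x_k)\in X^k$ is $\mathcal{F}_{\mathrm{pubd}}$-independent if for all neighborhoods $U_1,\dots,U_k$ of $x_1,\dots,x_k$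 respectively, $(U_1,\dots,U_k)$ has an independence set in $\mathcal{F}_{\mathrm{pubd}}$. $(X,T)$ is topological K if for every $k\in\mathbb{N}$ every $k$-tuple of nonempty open subsets of $X$ has an independence set in $\mathcal{F}_{\mathrm{pubd}}$. For an open cover $\mathcal{V}$ of $X$, $N(\mathcal{V})$ is the minimal cardinality of a subcover of $\mathcal{V}$. For $F=\{a_1<a_2<\cdots\}\in\mathcal{F}_{\inf}$ and an open cover $\mathcal{U}$, $h^F_{\mathrm{top}}(T,\mathcal{U})=\limsup_{n\to+\infty}\frac{1}{n}\log N\left(\bigvee_{i=1}^nT^{-a_i}\mathcal{U}\right)$. $(X,T)$ is $\mathcal{F}_{\inf}$-scattering if for every $F=\{a_1<a_2<\cdots\}\in\mathcal{F}_{\inf}$ and every finite cover $\mathcal{U}$ of $X$ by non-dense open subsets one has $\lim_{n\to+\infty}N\left(\bigvee_{i=1}^nT^{-a_i}\mathcal{U}\right)=\infty$. *)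

theory Defs
  imports "HOL-Analysis.Analysis"
begin

definition tds :: "'a topology \<Rightarrow> ('a \<Rightarrow> 'a) \<Rightarrow> bool" where
  "tds X T \<longleftrightarrow> topspace X \<noteq> {} \<and> compact_space X \<and> metrizable_space X \<and>
     continuous_map X X T \<and> T ` topspace X = topspace X"

definition preimage :: "'a topology \<Rightarrow> ('a \<Rightarrow> 'a) \<Rightarrow> nat \<Rightarrow> 'a set \<Rightarrow> 'a set" where
  "preimage X T j A = {z \<in> topspace X. (T ^^ j) z \<in> A}"

text \<open>Neighbourhoods need not be open.\<close>

definition neighborhood :: "'a topology \<Rightarrow> 'a \<Rightarrow> 'a set \<Rightarrow> bool" where
  "neighborhood X x U \<longleftrightarrow> U \<subseteq> topspace X \<and> x \<in> X interior_of U"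

text \<open>A \<open>k\<close>-tuple is a function on \<open>nat\<close> of which only the values at \<open>1, \<dots>, k\<close> are used.\<close>

definition independence_set ::
    "'a topology \<Rightarrow> ('a \<Rightarrow> 'a) \<Rightarrow> nat \<Rightarrow> (nat \<Rightarrow> 'a set) \<Rightarrow> nat set \<Rightarrow> bool" where
  "independence_set X T k A F \<longleftrightarrow>
     (\<forall>J. J \<subseteq> F \<and> finite J \<and> J \<noteq> {} \<longrightarrow>
        (\<forall>s \<in> J \<rightarrow>\<^sub>E {1..k}. (\<Inter>j\<in>J. preimage X T j (A (s j))) \<noteq> {}))"

definition nat_intervals :: "nat set set" where
  "nat_intervals = {{a..b} | a b. a \<le> b}"

text \<open>The filter expresses \<open>|I| \<rightarrow> \<infinity>\<close> for \<open>I\<close> ranging over nonempty finite intervals.\<close>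

definition upper_Banach_density :: "nat set \<Rightarrow> ereal" where
  "upper_Banach_density F =
     Limsup (inf (filtercomap card at_top) (principal nat_intervals))
       (\<lambda>I. ereal (real (card (F \<inter> I)) / real (card I)))"

definition F_pubd :: "nat set set" where
  "F_pubd = {F. upper_Banach_density F > 0}"

definition F_inf :: "nat set set" where
  "F_inf = {F. infinite F}"

definition pubd_independent :: "'a topology \<Rightarrow> ('a \<Rightarrow> 'a) \<Rightarrow> nat \<Rightarrow> (nat \<Rightarrow> 'a) \<Rightarrow> bool" where
  "pubd_independent X T k x \<longleftrightarrow>
     (\<forall>U. (\<forall>i\<in>{1..k}. neighborhood X (x i) (U i)) \<longrightarrow>
        (\<exists>F\<in>F_pubd. independence_set X T k U F))"

definition topological_K :: "'a topology \<Rightarrow> ('a \<Rightarrow> 'a) \<Rightarrow> bool" where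
  "topological_K X T \<longleftrightarrow>
     (\<forall>k\<ge>1. \<forall>A. (\<forall>i\<in>{1..k}. openin X (A i) \<and> A i \<noteq> {}) \<longrightarrow>
        (\<exists>F\<in>F_pubd. independence_set X T k A F))"

definition open_cover :: "'a topology \<Rightarrow> 'a set set \<Rightarrow> bool" where
  "open_cover X \<V> \<longleftrightarrow> (\<forall>V\<in>\<V>. openin X V) \<and> \<Union>\<V> = topspace X"

text \<open>The minimum exists for open covers of compact spaces; otherwise the value is meaningless.\<close>

definition cover_number :: "'a topology \<Rightarrow> 'a set set \<Rightarrow> nat" where
  "cover_number X \<V> = (LEAST m. \<exists>\<W>\<subseteq>\<V>. finite \<W> \<and> card \<W> = m \<and> \<Union>\<W> = topspace X)"

definition cover_preimage ::
    "'a topology \<Rightarrow> ('a \<Rightarrow> 'a) \<Rightarrow> nat \<Rightarrow> 'a set set \<Rightarrow> 'a set set" where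
  "cover_preimage X T j \<U> = preimage X T j ` \<U>"

text \<open>The join of the covers \<open>\<C> i\<close>, \<open>i \<in> I\<close>; the join over the empty index set is \<open>{X}\<close>.\<close>

definition cover_join :: "'a topology \<Rightarrow> 'i set \<Rightarrow> ('i \<Rightarrow> 'a set set) \<Rightarrow> 'a set set" where
  "cover_join X I \<C> = {topspace X \<inter> (\<Inter>i\<in>I. V i) | V. \<forall>i\<in>I. V i \<in> \<C> i}"

text \<open>For \<open>F = {a\<^sub>1 < a\<^sub>2 < \<dots>}\<close> this is the join of \<open>T\<^sup>-\<^sup>a \<U>\<close> over \<open>a = a\<^sub>1, \<dots>, a\<^sub>n\<close>; the library
  enumeration of \<open>F\<close> starts at \<open>0\<close>, so \<open>a\<^sub>i = enumerate F (i - 1)\<close>.\<close>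

definition sequence_join ::
    "'a topology \<Rightarrow> ('a \<Rightarrow> 'a) \<Rightarrow> nat set \<Rightarrow> 'a set set \<Rightarrow> nat \<Rightarrow> 'a set set" where
  "sequence_join X T F \<U> n =
     cover_join X {1..n} (\<lambda>i. cover_preimage X T (enumerate F (i - 1)) \<U>)"

definition h_top :: "'a topology \<Rightarrow> ('a \<Rightarrow> 'a) \<Rightarrow> nat set \<Rightarrow> 'a set set \<Rightarrow> ereal" where
  "h_top X T F \<U> =
     limsup (\<lambda>n. ereal (1 / real n * ln (real (cover_number X (sequence_join X T F \<U> n)))))"

definition inf_scattering :: "'a topology \<Rightarrow> ('a \<Rightarrow> 'a) \<Rightarrow> bool" where
  "inf_scattering X T \<longleftrightarrow>
     (\<forall>F\<in>F_inf. \<forall>\<U>. finite \<U> \<and> open_cover X \<U> \<and> (\<forall>V\<in>\<U>. X closure_of V \<noteq> topspace X) \<longrightarrow>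
        filterlim (\<lambda>n. cover_number X (sequence_join X T F \<U> n)) at_top sequentially)"

end

theory Submission
  imports Defs
begin

text \<open>
  Both halves rest on one estimate. Let \<open>V\<^sub>1, \<dots>, V\<^sub>k\<close> cover \<open>X\<close>, with \<open>k \<ge> 2\<close>, and let
  \<open>A\<^sub>i\<close> miss \<open>V\<^sub>i\<close>, where \<open>(A\<^sub>1, \<dots>, A\<^sub>k)\<close> has an independence set \<open>S\<close> of positive upper
  Banach density. Then the logarithm of the number of sets needed from the join of \<open>m\<close> pulled-back
  covers grows at least linearly in \<open>m\<close>, whatever the times \<open>a\<^sub>1, a\<^sub>2, \<dots>\<close> are.

  Averaging over translates inside a very long interval in which \<open>S\<close> is dense gives a \<open>t\<close> such that
  \<open>t + a\<^sub>i\<close> lies in \<open>S\<close> for a fixed positive proportion of the indices \<open>i \<le> m\<close>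
  (\<open>pubd_translate_meets_proportion\<close>). Let \<open>B\<close> be the set of these indices. Independence along \<open>S\<close>, after applying
  \<open>T\<^sup>t\<close>, realises each of the \<open>k\<^bsup>card B\<^esup>\<close> itineraries \<open>s : B \<rightarrow> {1, \<dots>, k}\<close> by a point \<open>y\<close>
  with \<open>T\<^sup>a y \<in> A\<^bsub>s i\<^esub>\<close> for \<open>a = a\<^sub>i\<close>. A member of the join only contains realising points of
  itineraries that differ everywhere on \<open>B\<close> from its own sequence of indices, hence accounts for at
  most \<open>(k - 1)\<^bsup>card B\<^esup>\<close> of them (\<open>avoiding_boxes_count\<close>). So at least \<open>(k / (k - 1))\<^bsup>card B\<^esup>\<close>
  members are needed, and \<open>card B\<close> is at least proportional to \<open>m\<close>.

  For the first half, \<open>A\<^sub>i\<close> is \<open>U\<^sub>i\<close> and \<open>V\<^sub>i\<close> its complement; these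
  complements cover \<open>X\<close> because \<open>U\<^sub>1\<close> and \<open>U\<^sub>2\<close> are disjoint. For the second, \<open>V\<^sub>i\<close> runs
  through the given cover and \<open>A\<^sub>i\<close> is the complement of the closure of \<open>V\<^sub>i\<close>, a nonempty open set.
\<close>

section \<open>Translates of a set of positive upper Banach density\<close>

lemma pubd_long_dense_intervals:
  assumes "S \<in> F_pubd"
  shows "\<exists>d>0. \<forall>L. \<exists>p q. p \<le> q \<and> L \<le> card {p..q} \<and>
           d * real (card {p..q}) < real (card (S \<inter> {p..q}))"
proof -
  let ?G = "inf (filtercomap card at_top) (principal nat_intervals)"
  let ?f = "\<lambda>I. ereal (real (card (S \<inter> I)) / real (card I))"
  have "0 < Limsup ?G ?f"
    using assms by (simp add: F_pubd_def upper_Banach_density_def)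
  then obtain d where d: "0 < ereal d" "ereal d < Limsup ?G ?f"
    using ereal_dense2 by blast
  have freq: "\<not> eventually (\<lambda>I. ?f I \<le> ereal d) ?G"
  proof
    assume "eventually (\<lambda>I. ?f I \<le> ereal d) ?G"
    then have "Limsup ?G ?f \<le> ereal d" by (rule Limsup_bounded)
    with d show False by simp
  qed
  have "\<exists>p q. p \<le> q \<and> L \<le> card {p..q} \<and> d * real (card {p..q}) < real (card (S \<inter> {p..q}))" for L
  proof (rule ccontr)
    assume no: "\<not> ?thesis"
    have "eventually (\<lambda>I. L \<le> card I) (filtercomap card at_top :: nat set filter)"
      by (intro eventually_filtercomapI eventually_ge_at_top)
    then have "eventually (\<lambda>I. ?f I \<le> ereal d) ?G"
      unfolding eventually_inf_principal
    proof (rule eventually_mono, intro impI)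
      fix I :: "nat set"
      assume L: "L \<le> card I" and "I \<in> nat_intervals"
      then obtain p q where I: "I = {p..q}" "p \<le> q" by (auto simp: nat_intervals_def)
      with no L have "real (card (S \<inter> I)) \<le> d * real (card I)" by (auto simp: not_less)
      moreover have "0 < real (card I)" using I by simp
      ultimately show "?f I \<le> ereal d" by (simp add: pos_divide_le_eq)
    qed
    with freq show False ..
  qed
  with d(1) show ?thesis by auto
qed

text \<open>
  Sliding a finite configuration through a long interval with density above \<open>d\<close>, each of its points
  lands in \<open>S\<close> for almost a proportion \<open>d\<close> of the translates: only the translates near the right
  end are lost. Averaging over the translates leaves \<open>d / 2\<close>. The bound does not depend on the
  configuration, which is what makes arbitrary sparse time sequences tractable.
\<close>

lemma pubd_translate_meets_proportion:
  assumes "S \<in> F_pubd"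
  shows "\<exists>c>0. \<forall>(I::'i set) e. finite I \<longrightarrow>
           (\<exists>t. c * real (card I) \<le> real (card {i\<in>I. t + e i \<in> S}))"
proof -
  obtain d where d: "d > 0" and long: "\<And>L. \<exists>p q. p \<le> q \<and> L \<le> card {p..q} \<and>
           d * real (card {p..q}) < real (card (S \<inter> {p..q}))"
    using pubd_long_dense_intervals[OF assms] by blast
  have "\<exists>t. d / 2 * real (card I) \<le> real (card {i\<in>I. t + e i \<in> S})"
    if fin: "finite I" for I :: "'i set" and e
  proof -
    define M where "M = (\<Sum>i\<in>I. e i)"
    have eM: "e i \<le> M" if "i \<in> I" for i
      unfolding M_def using fin that by (simp add: member_le_sum)
    \<comment> \<open>At this length the at most \<open>M\<close> lost translates cost no more than half of the density.\<close>
    obtain p q where pq: "p \<le> q" and len: "nat \<lceil>2 * real M / d\<rceil> \<le> card {p..q}"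
      and dens: "d * real (card {p..q}) < real (card (S \<inter> {p..q}))"
      using long by blast
    let ?L = "real (card {p..q})"
    have "2 * real M / d \<le> ?L" using len by linarith
    then have M: "real M \<le> d / 2 * ?L" using d by (simp add: field_simps)
    have each: "d / 2 * ?L \<le> real (card {t\<in>{p..q}. t + e i \<in> S})" if i: "i \<in> I" for i
    proof -
      have "S \<inter> {p..q} \<subseteq> (\<lambda>t. t + e i) ` {t\<in>{p..q}. t + e i \<in> S} \<union> {p..<p + e i}"
      proof
        fix x assume x: "x \<in> S \<inter> {p..q}"
        show "x \<in> (\<lambda>t. t + e i) ` {t\<in>{p..q}. t + e i \<in> S} \<union> {p..<p + e i}"
        proof (cases "x < p + e i")
          case False
          then have "x = (x - e i) + e i" "x - e i \<in> {t\<in>{p..q}. t + e i \<in> S}" using x by auto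
          then show ?thesis by blast
        qed (use x in auto)
      qed
      then have "card (S \<inter> {p..q}) \<le>
          card ((\<lambda>t. t + e i) ` {t\<in>{p..q}. t + e i \<in> S} \<union> {p..<p + e i})"
        by (intro card_mono) auto
      also have "\<dots> \<le> card ((\<lambda>t. t + e i) ` {t\<in>{p..q}. t + e i \<in> S}) + card {p..<p + e i}"
        by (rule card_Un_le)
      also have "\<dots> \<le> card {t\<in>{p..q}. t + e i \<in> S} + M"
        using eM[OF i] by (intro add_mono card_image_le) auto
      finally show ?thesis using dens M by linarith
    qed
    have swap: "(\<Sum>i\<in>I. card {t\<in>{p..q}. t + e i \<in> S}) = (\<Sum>t\<in>{p..q}. card {i\<in>I. t + e i \<in> S})"
      by (rule sum_multicount_gen) (use fin in auto)
    have "(\<Sum>t\<in>{p..q}. d / 2 * real (card I)) = (\<Sum>i\<in>I. d / 2 * ?L)"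
      by simp
    also have "\<dots> \<le> (\<Sum>i\<in>I. real (card {t\<in>{p..q}. t + e i \<in> S}))"
      by (intro sum_mono each)
    also have "\<dots> = (\<Sum>t\<in>{p..q}. real (card {i\<in>I. t + e i \<in> S}))"
      using swap by (simp flip: of_nat_sum)
    finally have le: "(\<Sum>t\<in>{p..q}. d / 2 * real (card I)) \<le>
        (\<Sum>t\<in>{p..q}. real (card {i\<in>I. t + e i \<in> S}))" .
    show ?thesis
    proof (rule ccontr)
      assume "\<not> ?thesis"
      then have "(\<Sum>t\<in>{p..q}. real (card {i\<in>I. t + e i \<in> S})) < (\<Sum>t\<in>{p..q}. d / 2 * real (card I))"
        using pq by (intro sum_strict_mono) (auto simp: not_le)
      with le show False by simp
    qed
  qed
  moreover have "d / 2 > 0" using d by simp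
  ultimately show ?thesis by blast
qed

section \<open>Itineraries realised along a dense set of times\<close>

text \<open>
  The point for \<open>s\<close> is the image under \<open>T\<^sup>t\<close> of a point that independence provides for the times
  \<open>t + e i\<close>. Injectivity of \<open>e\<close> makes \<open>s\<close> a well-defined choice on these times.
\<close>

lemma independence_translate:
  assumes cont: "continuous_map X X T" and ne: "topspace X \<noteq> {}"
    and ind: "independence_set X T k A S"
    and fin: "finite B" and inj: "inj_on e B" and BS: "\<And>i. i \<in> B \<Longrightarrow> t + e i \<in> S"
    and s: "s \<in> B \<rightarrow>\<^sub>E {1..k}"
  shows "\<exists>y\<in>topspace X. \<forall>i\<in>B. (T ^^ e i) y \<in> A (s i)"
proof (cases "B = {}")
  case True
  with ne show ?thesis by blast
next
  case False
  define f where "f = (\<lambda>i. t + e i)"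
  have injf: "inj_on f B" using inj by (simp add: f_def inj_on_def)
  let ?s = "restrict (s \<circ> inv_into B f) (f ` B)"
  have "?s \<in> f ` B \<rightarrow>\<^sub>E {1..k}"
    using s injf by (auto simp: PiE_iff)
  moreover have "f ` B \<subseteq> S" using BS by (auto simp: f_def)
  ultimately have "(\<Inter>j\<in>f ` B. preimage X T j (A (?s j))) \<noteq> {}"
    using ind fin False unfolding independence_set_def by blast
  then obtain z where z: "\<And>i. i \<in> B \<Longrightarrow> z \<in> preimage X T (f i) (A (?s (f i)))"
    by blast
  have zX: "z \<in> topspace X"
    using z False by (auto simp: preimage_def)
  have TX: "(T ^^ m) z \<in> topspace X" for m
    by (induction m) (use zX cont in \<open>auto simp: continuous_map_def\<close>)
  have "(T ^^ e i) ((T ^^ t) z) \<in> A (s i)" if i: "i \<in> B" for i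
  proof -
    have "(T ^^ f i) z \<in> A (s i)"
      using z[OF i] injf i by (simp add: preimage_def)
    moreover have "f i = e i + t" by (simp add: f_def)
    ultimately show ?thesis by (simp add: funpow_add)
  qed
  with TX show ?thesis by blast
qed

section \<open>Covering numbers of joins\<close>

lemma avoiding_boxes_count:
  assumes "finite B" "finite W"
    and g: "\<And>w i. w \<in> W \<Longrightarrow> i \<in> B \<Longrightarrow> g w i \<in> {1..k}"
    and cover: "(B \<rightarrow>\<^sub>E {1..k}) \<subseteq> (\<Union>w\<in>W. \<Pi>\<^sub>E i\<in>B. {1..k} - {g w i})"
  shows "k ^ card B \<le> card W * (k - 1) ^ card B"
proof -
  have "k ^ card B = card (B \<rightarrow>\<^sub>E {1..k})"
    using assms by (simp add: card_PiE)
  also have "\<dots> \<le> card (\<Union>w\<in>W. \<Pi>\<^sub>E i\<in>B. {1..k} - {g w i})"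
    using assms by (intro card_mono cover) (auto intro!: finite_PiE)
  also have "\<dots> \<le> (\<Sum>w\<in>W. card (\<Pi>\<^sub>E i\<in>B. {1..k} - {g w i}))"
    using assms by (intro card_UN_le)
  also have "\<dots> = (\<Sum>w\<in>W. (k - 1) ^ card B)"
  proof (rule sum.cong)
    fix w assume w: "w \<in> W"
    have "card (\<Pi>\<^sub>E i\<in>B. {1..k} - {g w i}) = (\<Prod>i\<in>B. card ({1..k} - {g w i}))"
      using assms by (simp add: card_PiE)
    also have "\<dots> = (\<Prod>i\<in>B. k - 1)"
      using g[OF w] by (intro prod.cong) (simp_all add: card_Diff_singleton)
    finally show "card (\<Pi>\<^sub>E i\<in>B. {1..k} - {g w i}) = (k - 1) ^ card B" by simp
  qed simp
  finally show ?thesis by simp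
qed

lemma finite_cover_join:
  assumes "finite I" "\<And>i. i \<in> I \<Longrightarrow> finite (C i)"
  shows "finite (cover_join X I C)"
proof -
  have "cover_join X I C \<subseteq> (\<lambda>V. topspace X \<inter> (\<Inter>i\<in>I. V i)) ` (\<Pi>\<^sub>E i\<in>I. C i)"
  proof
    fix w assume "w \<in> cover_join X I C"
    then obtain V where "w = topspace X \<inter> (\<Inter>i\<in>I. V i)" "\<forall>i\<in>I. V i \<in> C i"
      by (auto simp: cover_join_def)
    then have "w = topspace X \<inter> (\<Inter>i\<in>I. restrict V I i)" "restrict V I \<in> (\<Pi>\<^sub>E i\<in>I. C i)"
      by auto
    then show "w \<in> (\<lambda>V. topspace X \<inter> (\<Inter>i\<in>I. V i)) ` (\<Pi>\<^sub>E i\<in>I. C i)" by blast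
  qed
  moreover have "finite (\<Pi>\<^sub>E i\<in>I. C i)" using assms by (intro finite_PiE)
  ultimately show ?thesis using finite_surj by blast
qed

lemma Union_cover_join:
  assumes "\<And>i. i \<in> I \<Longrightarrow> topspace X \<subseteq> \<Union>(C i)"
  shows "\<Union>(cover_join X I C) = topspace X"
proof
  show "\<Union>(cover_join X I C) \<subseteq> topspace X" by (auto simp: cover_join_def)
  show "topspace X \<subseteq> \<Union>(cover_join X I C)"
  proof
    fix y assume y: "y \<in> topspace X"
    then have "\<forall>i\<in>I. \<exists>v. v \<in> C i \<and> y \<in> v" using assms by blast
    then obtain V where V: "\<forall>i\<in>I. V i \<in> C i \<and> y \<in> V i" by metis
    then have "topspace X \<inter> (\<Inter>i\<in>I. V i) \<in> cover_join X I C" by (auto simp: cover_join_def)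
    with V y show "y \<in> \<Union>(cover_join X I C)" by blast
  qed
qed

lemma cover_number_attained:
  assumes "finite \<V>" "\<Union>\<V> = topspace X"
  obtains \<W> where "\<W> \<subseteq> \<V>" "finite \<W>" "card \<W> = cover_number X \<V>" "\<Union>\<W> = topspace X"
proof -
  have "\<exists>m. \<exists>\<W>\<subseteq>\<V>. finite \<W> \<and> card \<W> = m \<and> \<Union>\<W> = topspace X"
    using assms by blast
  from LeastI_ex[OF this] show ?thesis
    using that unfolding cover_number_def by blast
qed

lemma sequence_join_member:
  assumes "w \<in> sequence_join X T F (V ` {1..k}) m"
  shows "\<exists>g. \<forall>i\<in>{1..m}. g i \<in> {1..k} \<and> (\<forall>y\<in>w. (T ^^ enumerate F (i - 1)) y \<in> V (g i))"
proof -
  obtain P where w: "w = topspace X \<inter> (\<Inter>i\<in>{1..m}. P i)"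
    and P: "\<forall>i\<in>{1..m}. P i \<in> cover_preimage X T (enumerate F (i - 1)) (V ` {1..k})"
    using assms by (auto simp: sequence_join_def cover_join_def)
  have "\<forall>i\<in>{1..m}. \<exists>j. j \<in> {1..k} \<and> P i = preimage X T (enumerate F (i - 1)) (V j)"
    using P unfolding cover_preimage_def image_image by blast
  then obtain g where
    "\<forall>i\<in>{1..m}. g i \<in> {1..k} \<and> P i = preimage X T (enumerate F (i - 1)) (V (g i))"
    by metis
  with w show ?thesis by (intro exI[of _ g]) (auto simp: preimage_def)
qed

text \<open>
  An itinerary \<open>s\<close> on \<open>B\<close> is realised by a point \<open>y\<close> in some member of an optimal subcover.
  Whenever that member places \<open>T\<^sup>a y\<close> (\<open>a\<close> the \<open>i\<close>-th time) in \<open>V\<^sub>j\<close>, the itinerary has \<open>s i \<noteq> j\<close>,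
  as \<open>A\<^sub>j\<close> misses \<open>V\<^sub>j\<close>. Thus the boxes of itineraries avoiding the indices of a member cover all
  itineraries, and counting gives the lower bound \<open>(k / (k - 1))\<^bsup>card B\<^esup>\<close>.
\<close>

lemma cover_number_sequence_join_exponential:
  assumes sys: "tds X T" and F: "infinite F" and k: "k \<ge> 2"
    and cov: "\<Union>(V ` {1..k}) = topspace X"
    and disj: "\<And>i. i \<in> {1..k} \<Longrightarrow> A i \<inter> V i = {}"
    and S: "S \<in> F_pubd" and ind: "independence_set X T k A S"
  shows "\<exists>c>0. \<forall>m. c * real m \<le> ln (real (cover_number X (sequence_join X T F (V ` {1..k}) m)))"
proof -
  have cont: "continuous_map X X T" and ne: "topspace X \<noteq> {}"
    using sys by (auto simp: tds_def)
  have TX: "(T ^^ j) y \<in> topspace X" if "y \<in> topspace X" for j y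
    by (induction j) (use that cont in \<open>auto simp: continuous_map_def\<close>)
  obtain c where c: "c > 0" and meets: "\<And>(I::nat set) e. finite I \<Longrightarrow>
      \<exists>t. c * real (card I) \<le> real (card {i\<in>I. t + e i \<in> S})"
    using pubd_translate_meets_proportion[OF S] by blast
  define r where "r = ln (real k / real (k - 1))"
  have r: "r > 0" using k by (simp add: r_def)
  have "c * r * real m \<le> ln (real (cover_number X (sequence_join X T F (V ` {1..k}) m)))" for m
  proof -
    let ?e = "\<lambda>i. enumerate F (i - 1)"
    let ?J = "sequence_join X T F (V ` {1..k}) m"
    obtain t where t: "c * real m \<le> real (card {i\<in>{1..m}. t + ?e i \<in> S})"
      using meets[of "{1..m}" ?e] by auto
    define B where "B = {i\<in>{1..m}. t + ?e i \<in> S}"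
    have finB: "finite B" by (simp add: B_def)
    have "inj_on ?e {1..m}"
    proof (rule inj_onI)
      fix i j assume "i \<in> {1..m}" "j \<in> {1..m}" and eq: "?e i = ?e j"
      moreover have "i - 1 = j - 1"
        using eq strict_mono_enumerate[OF F] by (simp add: strict_mono_eq)
      ultimately show "i = j" by auto
    qed
    then have injB: "inj_on ?e B" by (rule inj_on_subset) (auto simp: B_def)
    have "finite ?J"
      unfolding sequence_join_def by (intro finite_cover_join) (auto simp: cover_preimage_def)
    moreover have "\<Union>?J = topspace X"
      unfolding sequence_join_def
    proof (rule Union_cover_join, rule subsetI)
      fix i y assume y: "y \<in> topspace X"
      then have "(T ^^ ?e i) y \<in> \<Union>(V ` {1..k})" using TX cov by simp
      with y show "y \<in> \<Union>(cover_preimage X T (?e i) (V ` {1..k}))"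
        by (auto simp: cover_preimage_def preimage_def)
    qed
    ultimately obtain W where W: "W \<subseteq> ?J" "finite W" "card W = cover_number X ?J"
      "\<Union>W = topspace X"
      by (rule cover_number_attained)
    have "\<forall>w\<in>W. \<exists>g. \<forall>i\<in>{1..m}. g i \<in> {1..k} \<and> (\<forall>y\<in>w. (T ^^ ?e i) y \<in> V (g i))"
      using W(1) sequence_join_member by blast
    then obtain g where
      g: "\<And>w i. w \<in> W \<Longrightarrow> i \<in> {1..m} \<Longrightarrow> g w i \<in> {1..k} \<and> (\<forall>y\<in>w. (T ^^ ?e i) y \<in> V (g w i))"
      by metis
    have "(B \<rightarrow>\<^sub>E {1..k}) \<subseteq> (\<Union>w\<in>W. \<Pi>\<^sub>E i\<in>B. {1..k} - {g w i})"
    proof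
      fix s assume s: "s \<in> B \<rightarrow>\<^sub>E {1..k}"
      obtain y where y: "y \<in> topspace X" "\<And>i. i \<in> B \<Longrightarrow> (T ^^ ?e i) y \<in> A (s i)"
        using independence_translate[OF cont ne ind finB injB _ s, of t] by (auto simp: B_def)
      obtain w where w: "w \<in> W" "y \<in> w" using y(1) W(4) by blast
      have "s i \<noteq> g w i" if i: "i \<in> B" for i
      proof
        assume eq: "s i = g w i"
        have im: "i \<in> {1..m}" using i by (simp add: B_def)
        have "(T ^^ ?e i) y \<in> A (g w i) \<inter> V (g w i)"
          using y(2)[OF i] g[OF w(1) im] w(2) eq by auto
        with disj g[OF w(1) im] show False by blast
      qed
      with s w(1) show "s \<in> (\<Union>w\<in>W. \<Pi>\<^sub>E i\<in>B. {1..k} - {g w i})" by (auto simp: PiE_iff)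
    qed
    then have count: "k ^ card B \<le> cover_number X ?J * (k - 1) ^ card B"
      using avoiding_boxes_count[OF finB W(2), of g k] g k W(3) by (auto simp: B_def)
    have "real k ^ card B \<le> real (cover_number X ?J) * real (k - 1) ^ card B"
      using count unfolding of_nat_power[symmetric] of_nat_mult[symmetric] of_nat_le_iff .
    then have "(real k / real (k - 1)) ^ card B \<le> real (cover_number X ?J)"
      using k by (simp add: power_divide pos_divide_le_eq)
    then have "ln ((real k / real (k - 1)) ^ card B) \<le> ln (real (cover_number X ?J))"
      using k by (intro ln_mono) auto
    moreover have "ln ((real k / real (k - 1)) ^ card B) = real (card B) * r"
      using k unfolding r_def by (intro ln_realpow)
    moreover have "c * real m * r \<le> real (card B) * r"
      using t r by (intro mult_right_mono) (auto simp: B_def)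
    ultimately show ?thesis by (simp add: algebra_simps)
  qed
  moreover have "c * r > 0" using c r by simp
  ultimately show ?thesis by blast
qed

section \<open>Positive sequence entropy and scattering\<close>

theorem theorem7p1:
  fixes X :: "'a topology" and T :: "'a \<Rightarrow> 'a"
  assumes "tds X T"
  shows "(\<forall>(n::nat) (x :: nat \<Rightarrow> 'a) (U :: nat \<Rightarrow> 'a set).
            n \<ge> 2 \<and>
            (\<forall>i\<in>{1..n}. x i \<in> topspace X) \<and>
            pubd_independent X T n x \<and>
            inj_on x {1..n} \<and>
            (\<forall>i\<in>{1..n}. closedin X (U i) \<and> neighborhood X (x i) (U i)) \<and>
            disjoint_family_on U {1..n} \<longrightarrow>
            (\<forall>F\<in>F_inf. h_top X T F ((\<lambda>i. topspace X - U i) ` {1..n}) > 0))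
       \<and> (topological_K X T \<longrightarrow> inf_scattering X T)"
proof (intro conjI allI impI ballI)
  fix n :: nat and x :: "nat \<Rightarrow> 'a" and U :: "nat \<Rightarrow> 'a set" and F :: "nat set"
  assume "n \<ge> 2 \<and> (\<forall>i\<in>{1..n}. x i \<in> topspace X) \<and> pubd_independent X T n x \<and>
    inj_on x {1..n} \<and> (\<forall>i\<in>{1..n}. closedin X (U i) \<and> neighborhood X (x i) (U i)) \<and>
    disjoint_family_on U {1..n}"
  then have n: "n \<ge> 2" and pi: "pubd_independent X T n x"
    and nb: "\<forall>i\<in>{1..n}. neighborhood X (x i) (U i)" and dis: "disjoint_family_on U {1..n}"
    by blast+
  assume "F \<in> F_inf"
  then have F: "infinite F" by (simp add: F_inf_def)
  obtain S where S: "S \<in> F_pubd" "independence_set X T n U S"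
    using pi nb unfolding pubd_independent_def by blast
  let ?V = "\<lambda>i. topspace X - U i"
  have "U 1 \<inter> U 2 = {}"
    using dis n by (auto simp: disjoint_family_on_def)
  moreover have "1 \<in> {1..n}" "2 \<in> {1..n}" using n by auto
  ultimately have "\<Union>(?V ` {1..n}) = topspace X" by blast
  then obtain c where c: "c > 0"
    and bound: "\<And>m. c * real m \<le> ln (real (cover_number X (sequence_join X T F (?V ` {1..n}) m)))"
    using cover_number_sequence_join_exponential[OF assms F n _ _ S, of ?V] by blast
  have "ereal c \<le> h_top X T F (?V ` {1..n})"
    unfolding h_top_def
  proof (rule le_Limsup)
    show "eventually (\<lambda>m. ereal c \<le> ereal (1 / real m *
        ln (real (cover_number X (sequence_join X T F (?V ` {1..n}) m))))) sequentially"
      using eventually_gt_at_top[of 0]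
    proof eventually_elim
      case (elim m)
      then show ?case using bound[of m] by (simp add: field_simps)
    qed
  qed simp
  with c show "0 < h_top X T F (?V ` {1..n})"
    by (metis ereal_less(2) less_le_trans)
next
  assume K: "topological_K X T"
  show "inf_scattering X T"
    unfolding inf_scattering_def
  proof (intro ballI allI impI)
    fix F \<U>
    assume "F \<in> F_inf" and "finite \<U> \<and> open_cover X \<U> \<and> (\<forall>V\<in>\<U>. X closure_of V \<noteq> topspace X)"
    then have F: "infinite F" and fin: "finite \<U>" and cov: "\<Union>\<U> = topspace X"
      and nd: "\<And>V. V \<in> \<U> \<Longrightarrow> X closure_of V \<noteq> topspace X"
      by (auto simp: F_inf_def open_cover_def)
    have ne: "topspace X \<noteq> {}" using assms by (simp add: tds_def)
    obtain V where "bij_betw V {1..card \<U>} \<U>"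
      using ex_bij_betw_nat_finite_1[OF fin] by blast
    then have V: "V ` {1..card \<U>} = \<U>" by (simp add: bij_betw_def)
    have "\<U> \<noteq> {}"
    proof
      assume "\<U> = {}"
      then have "topspace X = {}" unfolding cov[symmetric] by (simp only: Union_empty)
      with ne show False ..
    qed
    then have "card \<U> \<noteq> 0" using fin by simp
    \<comment> \<open>A one-element cover would be \<open>{X}\<close>, and \<open>X\<close> is dense.\<close>
    moreover have "card \<U> \<noteq> 1"
    proof
      assume "card \<U> = 1"
      then obtain v where v: "\<U> = {v}" by (auto simp: card_1_singleton_iff)
      with cov have "v = topspace X" by simp
      with nd[of v] v show False by simp
    qed
    ultimately have k: "card \<U> \<ge> 2" by linarith
    let ?A = "\<lambda>i. topspace X - X closure_of V i"
    have "openin X (?A i) \<and> ?A i \<noteq> {}" if "i \<in> {1..card \<U>}" for i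
    proof -
      have "V i \<in> \<U>" using V that by blast
      with nd have "X closure_of V i \<noteq> topspace X" by blast
      then show ?thesis
        using closure_of_subset_topspace[of X "V i"] by (auto intro: openin_diff)
    qed
    then have "\<exists>S\<in>F_pubd. independence_set X T (card \<U>) ?A S"
      using K[unfolded topological_K_def, rule_format, of "card \<U>" ?A] k by simp
    then obtain S where S: "S \<in> F_pubd" "independence_set X T (card \<U>) ?A S" by blast
    have disj: "?A i \<inter> V i = {}" if "i \<in> {1..card \<U>}" for i
    proof -
      have "V i \<subseteq> topspace X" using V that cov by blast
      then show ?thesis using closure_of_subset[of "V i" X] by blast
    qed
    obtain c where c: "c > 0"
      and bound: "\<And>m. c * real m \<le> ln (real (cover_number X (sequence_join X T F \<U> m)))"
      using cover_number_sequence_join_exponential[OF assms F k _ disj S]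
      unfolding V using cov by blast
    have "c * real m \<le> real (cover_number X (sequence_join X T F \<U> m))" for m
    proof -
      have "ln (real N) \<le> real N" for N :: nat
        using ln_le_minus_one[of "real N"] by (cases "N = 0") auto
      with bound[of m] show ?thesis by (rule order_trans)
    qed
    moreover have "filterlim (\<lambda>m. c * real m) at_top sequentially"
      using c by (intro filterlim_tendsto_pos_mult_at_top[OF tendsto_const _ filterlim_real_sequentially])
    ultimately have "filterlim (\<lambda>m. real (cover_number X (sequence_join X T F \<U> m))) at_top sequentially"
      by (auto intro: filterlim_at_top_mono[where f = "\<lambda>m. c * real m"])
    then show "filterlim (\<lambda>m. cover_number X (sequence_join X T F \<U> m)) at_top sequentially"
      by (simp add: filterlim_sequentially_iff_filterlim_real)
  qed
qed

end
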